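(* Let $(A,B)$ be a symmetric ideal degree-three Prouhet--Tarry--Escott solution with center $c\in\frac12\mathbb Z$. Then, after subtracting $c$ and multiplying all centered coordinates by $2$, one may write $$2(A-c)=\{\pm x,\pm y\},\qquad 2(B-c)=\{\pm u,\pm v\},$$ where $x,y,u,v\in\mathbb Z$ have the same parity. In these coordinates, $(A,B)$ is an ideal degree-three Prouhet--Tarry--Escott solution if and only if $$x^2+y^2=u^2+v^2.$$
   Context: Multisets are counted with multiplicity. A pair $(A,B)$ of four-element multisets of integers is an ideal degree-three Prouhet--Tarry--Escott solution if $\sum_{a\in A}a^\ell=\sum_{b\in B}b^\ell$ for $\ell=1,2,3$. An ideal degree-three Prouhet--Tarry--Escott solution $(A,B)$ is called symmetric if there exists $c\in\frac12\mathbb Z$ (its center) such that both centered multisets $A-c=\{a-c:a\in A\}$ and $B-c=\{b-c:b\in B\}$ are invariant under sign reversal $t\mapsto -t$ (as multisets); equivalently, its entries are paired by reflection about a common center. Here $2(A-c)=\{2(a-c):a\in A\}$, and similarly for $B$; the notation $\{\pm x,\pm y\}$ means the four-element multiset $\{x,-x,y,-y\}$. *)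

theory Defs
  imports Complex_Main "HOL-Library.Multiset"
begin

text \<open>As in the source, the trivial case \<open>A = B\<close> is not excluded.\<close>
definition ideal_pte3 :: "int multiset \<Rightarrow> int multiset \<Rightarrow> bool" where
  "ideal_pte3 A B \<longleftrightarrow>
     size A = 4 \<and> size B = 4 \<and>
     (\<forall>l\<in>{1, 2, 3::nat}. (\<Sum>a\<in>#A. a ^ l) = (\<Sum>b\<in>#B. b ^ l))"

definition half_ints :: "rat set" where
  "half_ints = {of_int n / 2 | n :: int. True}"

definition centered :: "int multiset \<Rightarrow> rat \<Rightarrow> rat multiset" where
  "centered A c = {# of_int a - c. a \<in># A #}"

definition sign_invariant :: "rat multiset \<Rightarrow> bool" where
  "sign_invariant M \<longleftrightarrow> {# - t. t \<in># M #} = M"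

definition is_center :: "int multiset \<Rightarrow> int multiset \<Rightarrow> rat \<Rightarrow> bool" where
  "is_center A B c \<longleftrightarrow>
     c \<in> half_ints \<and> sign_invariant (centered A c) \<and> sign_invariant (centered B c)"

definition pm :: "int \<Rightarrow> int \<Rightarrow> int multiset" where
  "pm x y = {# x, - x, y, - y #}"

definition same_parity :: "int set \<Rightarrow> bool" where
  "same_parity S \<longleftrightarrow> (\<forall>s\<in>S. \<forall>t\<in>S. even s \<longleftrightarrow> even t)"

text \<open>The integers \<open>x, y, u, v\<close> are coordinates of \<open>(A, B)\<close> about \<open>c\<close>:
  \<open>2 (A - c) = {\<plusminus>x, \<plusminus>y}\<close> and \<open>2 (B - c) = {\<plusminus>u, \<plusminus>v}\<close>. Equality is between
  rational multisets, hence the coercion of the right-hand sides. That \<open>(A, B)\<close>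
  solves the Prouhet--Tarry--Escott equations is not part of this definition.\<close>
definition centered_coordinates ::
  "int multiset \<Rightarrow> int multiset \<Rightarrow> rat \<Rightarrow> int \<Rightarrow> int \<Rightarrow> int \<Rightarrow> int \<Rightarrow> bool" where
  "centered_coordinates A B c x y u v \<longleftrightarrow>
     {# 2 * t. t \<in># centered A c #} = image_mset of_int (pm x y) \<and>
     {# 2 * t. t \<in># centered B c #} = image_mset of_int (pm u v) \<and>
     same_parity {x, y, u, v}"

end

theory Submission
  imports Defs
begin

text \<open>With \<open>n = 2 c\<close>, the doubled centered entries of \<open>A\<close> are the integers \<open>2 a - n\<close>, all congruent
  to \<open>n\<close> modulo 2. A multiset of integers that is invariant under negation and has at least two
  elements contains a pair \<open>\<plusminus>x\<close>; removing such pairs gives the coordinates. In the coordinates the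
  odd power sums vanish and the quadratic one is \<open>2 (x\<^sup>2 + y\<^sup>2)\<close>; expanding \<open>(2 a - n)^l\<close> carries
  this back to the power sums of \<open>A\<close>.\<close>

text \<open>A nonzero element and its negative are distinct members, and without nonzero elements
  two copies of 0 form the pair. The pair is itself symmetric, so cancelling it keeps the remainder
  symmetric.\<close>

lemma symmetric_mset_obtain_pair:
  fixes M :: "int multiset"
  assumes sym: "image_mset uminus M = M" and size: "size M \<ge> 2"
  obtains x N where "M = add_mset x (add_mset (- x) N)" "image_mset uminus N = N"
proof -
  have "\<exists>x. {#x, - x#} \<subseteq># M"
  proof (cases "\<exists>x\<in>#M. x \<noteq> 0")
    case True
    then obtain x where x: "x \<in># M" "x \<noteq> 0" by blast
    then have "- x \<in># image_mset uminus M" by simp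
    \<comment> \<open>Since \<open>x \<noteq> 0\<close>, \<open>- x\<close> differs from
      \<open>x\<close> and survives the removal of one \<open>x\<close>.\<close>
    with x sym have "- x \<in># M - {#x#}" by (simp add: in_diff_count)
    with x show ?thesis by (auto simp: insert_subset_eq_iff)
  next
    case False
    then have "M = replicate_mset (size M) 0"
      by (metis size_eq_0_iff_empty in_replicate_mset set_mset_eq_empty_iff set_mset_subset_singletonD
          subsetI singletonI)
    \<comment> \<open>As 0 is its own negative, the pair needs multiplicity two, which the size
      bound supplies.\<close>
    moreover have "{#0, - 0#} \<subseteq># replicate_mset (size M) (0::int)"
      using size by (simp add: subseteq_mset_def)
    ultimately show ?thesis by metis
  qed
  then obtain x N where M: "M = add_mset x (add_mset (- x) N)"
    by (auto simp: mset_subset_eq_exists_conv)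
  have "image_mset uminus N = N"
    using sym unfolding M by (simp add: add_mset_commute)
  with M that show thesis by blast
qed

text \<open>Two pairs are split off in turn; counting elements shows that nothing is left.\<close>

lemma symmetric_mset_size_4_eq_pm:
  assumes "image_mset uminus M = M" "size M = 4"
  obtains x y where "M = pm x y"
proof -
  obtain x N where N: "M = add_mset x (add_mset (- x) N)" "image_mset uminus N = N"
    using symmetric_mset_obtain_pair[OF assms(1)] assms(2) by auto
  with assms have "size N = 2" by simp
  then obtain y K where "N = add_mset y (add_mset (- y) K)"
    using symmetric_mset_obtain_pair[OF N(2)] by (metis order_refl)
  with N \<open>size N = 2\<close> have "M = pm x y" by (simp add: pm_def)
  then show thesis by (rule that)
qed

lemma double_centered:
  assumes "c = of_int n / 2"
  shows "{# 2 * t. t \<in># centered A c #} = image_mset of_int {# 2 * a - n. a \<in># A #}"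
  using assms by (simp add: centered_def multiset.map_comp comp_def algebra_simps)

lemma image_of_int_eq_iff:
  "image_mset (of_int :: int \<Rightarrow> 'a::ring_char_0) M = image_mset of_int N \<longleftrightarrow> M = N"
  by (rule inj_eq) (intro injI, auto dest: multiset.inj_map_strong[rotated])

text \<open>Negation commutes with doubling and with \<open>of_int\<close>, so the symmetry passes
  to the integer entries by injectivity of the coercion.\<close>

lemma sign_invariant_centered_imp:
  assumes c: "c = of_int n / 2" and inv: "sign_invariant (centered A c)"
  shows "image_mset uminus {# 2 * a - n. a \<in># A #} = {# 2 * a - n. a \<in># A #}"
proof -
  have "image_mset (of_int :: int \<Rightarrow> rat) (image_mset uminus {# 2 * a - n. a \<in># A #})
      = image_mset uminus (image_mset of_int {# 2 * a - n. a \<in># A #})"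
    by (simp add: multiset.map_comp comp_def)
  also have "\<dots> = {# 2 * t. t \<in># {# - t. t \<in># centered A c #} #}"
    unfolding double_centered[OF c, symmetric] by (simp add: multiset.map_comp comp_def)
  also have "\<dots> = image_mset of_int {# 2 * a - n. a \<in># A #}"
    using inv by (simp only: sign_invariant_def double_centered[OF c])
  finally show ?thesis by (simp only: image_of_int_eq_iff)
qed

text \<open>Injectivity of \<open>of_int\<close> turns the rational equations into integer ones.
  Every \<open>2 * a - n\<close> has the parity of \<open>n\<close>, and the coordinates occur among
  these entries, whence \<open>same_parity\<close>.\<close>

lemma centered_coordinates_iff:
  assumes "c = of_int n / 2"
  shows "centered_coordinates A B c x y u v \<longleftrightarrow>
    {# 2 * a - n. a \<in># A #} = pm x y \<and> {# 2 * b - n. b \<in># B #} = pm u v"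
proof -
  have parity: "even s \<longleftrightarrow> even n" if "s \<in># {# 2 * a - n. a \<in># M #}" for s M
    using that by auto
  have "same_parity {x, y, u, v}"
    if "{# 2 * a - n. a \<in># A #} = pm x y" "{# 2 * b - n. b \<in># B #} = pm u v"
    using parity[of _ A] parity[of _ B] unfolding that pm_def same_parity_def by auto
  then show ?thesis
    unfolding centered_coordinates_def double_centered[OF assms] image_of_int_eq_iff by blast
qed

lemma power_sums_affine:
  fixes A :: "int multiset"
  shows "(\<Sum>a\<in>#A. 2 * a - n) = 2 * (\<Sum>a\<in>#A. a) - n * int (size A)"
    and "(\<Sum>a\<in>#A. (2 * a - n) ^ 2) =
      4 * (\<Sum>a\<in>#A. a ^ 2) - 4 * n * (\<Sum>a\<in>#A. a) + n ^ 2 * int (size A)"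
    and "(\<Sum>a\<in>#A. (2 * a - n) ^ 3) =
      8 * (\<Sum>a\<in>#A. a ^ 3) - 12 * n * (\<Sum>a\<in>#A. a ^ 2) + 6 * n ^ 2 * (\<Sum>a\<in>#A. a)
        - n ^ 3 * int (size A)"
  by (induction A) (simp_all add: algebra_simps power2_eq_square power3_eq_cube)

text \<open>The power sums of \<open>pm x y\<close> are known, the odd ones being 0, and the affine
  expansions are solved for those of \<open>A\<close>. The coordinates enter only through the
  quadratic sum.\<close>

lemma power_sums_of_coordinates:
  assumes "{# 2 * a - n. a \<in># A #} = pm x y"
  shows "size A = 4"
    and "(\<Sum>a\<in>#A. a) = 2 * n"
    and "2 * (\<Sum>a\<in>#A. a ^ 2) = x\<^sup>2 + y\<^sup>2 + 2 * n\<^sup>2"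
    and "2 * (\<Sum>a\<in>#A. a ^ 3) = 3 * n * (\<Sum>a\<in>#A. a ^ 2) - 2 * n ^ 3"
proof -
  show size: "size A = 4"
    using arg_cong[OF assms, of size] by (simp add: pm_def)
  \<comment> \<open>Leaving \<open>f\<close> arbitrary lets one identity serve the exponents 1, 2
    and 3.\<close>
  have push: "(\<Sum>a\<in>#A. f (2 * a - n)) = f x + f (- x) + f y + f (- y)" for f :: "int \<Rightarrow> int"
    using arg_cong[OF assms, of "\<lambda>M. \<Sum>s\<in>#M. f s"]
    by (simp add: pm_def multiset.map_comp comp_def)
  show S1: "(\<Sum>a\<in>#A. a) = 2 * n"
    using push[of "\<lambda>s. s"] power_sums_affine(1)[where A = A and n = n] size by simp
  show "2 * (\<Sum>a\<in>#A. a ^ 2) = x\<^sup>2 + y\<^sup>2 + 2 * n\<^sup>2"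
    using push[of "\<lambda>s. s ^ 2"] power_sums_affine(2)[where A = A and n = n] size S1
    by (simp add: power2_eq_square)
  show "2 * (\<Sum>a\<in>#A. a ^ 3) = 3 * n * (\<Sum>a\<in>#A. a ^ 2) - 2 * n ^ 3"
    using push[of "\<lambda>s. s ^ 3"] power_sums_affine(3)[where A = A and n = n] size S1
    by (simp add: power2_eq_square power3_eq_cube)
qed

lemma ideal_pte3_iff_coordinates:
  assumes A: "{# 2 * a - n. a \<in># A #} = pm x y" and B: "{# 2 * b - n. b \<in># B #} = pm u v"
  shows "ideal_pte3 A B \<longleftrightarrow> x\<^sup>2 + y\<^sup>2 = u\<^sup>2 + v\<^sup>2"
proof
  assume "ideal_pte3 A B"
  then have "(\<Sum>a\<in>#A. a ^ 2) = (\<Sum>b\<in>#B. b ^ 2)" by (simp add: ideal_pte3_def)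
  then show "x\<^sup>2 + y\<^sup>2 = u\<^sup>2 + v\<^sup>2"
    using power_sums_of_coordinates(3)[OF A] power_sums_of_coordinates(3)[OF B] by simp
next
  assume "x\<^sup>2 + y\<^sup>2 = u\<^sup>2 + v\<^sup>2"
  then have S2: "(\<Sum>a\<in>#A. a ^ 2) = (\<Sum>b\<in>#B. b ^ 2)"
    using power_sums_of_coordinates(3)[OF A] power_sums_of_coordinates(3)[OF B] by simp
  \<comment> \<open>The same \<open>n\<close> serves both multisets, so equal quadratic sums force
    equal cubic sums.\<close>
  then have "(\<Sum>a\<in>#A. a ^ 3) = (\<Sum>b\<in>#B. b ^ 3)"
    using power_sums_of_coordinates(4)[OF A] power_sums_of_coordinates(4)[OF B] by simp
  with S2 show "ideal_pte3 A B"
    using power_sums_of_coordinates(1,2)[OF A] power_sums_of_coordinates(1,2)[OF B]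
    by (simp add: ideal_pte3_def)
qed

theorem proposition2p3:
  "(\<forall>A B c. ideal_pte3 A B \<and> is_center A B c \<longrightarrow>
      (\<exists>x y u v. centered_coordinates A B c x y u v)) \<and>
   (\<forall>A B. \<forall>c\<in>half_ints. \<forall>x y u v. centered_coordinates A B c x y u v \<longrightarrow>
      (ideal_pte3 A B \<longleftrightarrow> x\<^sup>2 + y\<^sup>2 = u\<^sup>2 + v\<^sup>2))"
proof (intro conjI allI impI ballI)
  fix A B c
  assume "ideal_pte3 A B \<and> is_center A B c"
  then have size: "size A = 4" "size B = 4"
    and inv: "sign_invariant (centered A c)" "sign_invariant (centered B c)"
    and "c \<in> half_ints"
    by (auto simp: ideal_pte3_def is_center_def)
  then obtain n where c: "c = of_int n / 2" by (auto simp: half_ints_def)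
  obtain x y where "{# 2 * a - n. a \<in># A #} = pm x y"
    using symmetric_mset_size_4_eq_pm[OF sign_invariant_centered_imp[OF c inv(1)]] size by auto
  moreover obtain u v where "{# 2 * b - n. b \<in># B #} = pm u v"
    using symmetric_mset_size_4_eq_pm[OF sign_invariant_centered_imp[OF c inv(2)]] size by auto
  ultimately show "\<exists>x y u v. centered_coordinates A B c x y u v"
    unfolding centered_coordinates_iff[OF c] by blast
next
  fix A B c x y u v
  assume "c \<in> half_ints" and coords: "centered_coordinates A B c x y u v"
  then obtain n where c: "c = of_int n / 2" by (auto simp: half_ints_def)
  show "ideal_pte3 A B \<longleftrightarrow> x\<^sup>2 + y\<^sup>2 = u\<^sup>2 + v\<^sup>2"
    using coords unfolding centered_coordinates_iff[OF c]
    by (metis ideal_pte3_iff_coordinates)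
qed

end
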